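(* Let $K$ be an algebraically closed field of characteristic $0$. For every $n\geq 1$, the algebra $M_n(K)$ endowed with the Pauli grading does not satisfy the primeness property for graded central polynomials.
   Context: The Pauli grading on $M_n(K)$ is the following $\mathbb Z_n\times\mathbb Z_n$-grading: let $\varepsilon\in K$ be a primitive $n$-th root of unity, $X=\operatorname{diag}(\varepsilon^{n-1},\varepsilon^{n-2},\dots,\varepsilon,1)$ and $Y=e_{n,1}+\sum_{i=1}^{n-1}e_{i,i+1}$ (where $e_{i,j}$ are the matrix units); the homogeneous component of degree $(\bar i,\bar j)$ is $\operatorname{span}_K\{X^iY^j\}$. For a finite abelian group $G$, $K\langle X_G\rangle$ is the free unitary associative $G$-graded algebra on countably infinite disjoint sets $X_g$ ($g\in G$) of variables of degree $g$, written $x_i^{(g)}$. Let $A=\bigoplus_{g\in G}A_g$ be a $G$-graded algebra. A polynomial $f(x_1^{(g_1)},\dots,x_n^{(g_n)})\in K\langle X_G\rangle$ is a graded identity of $A$ if it vanishes under all substitutions $x_i^{(g_i)}\mapsto a_i\in A_{g_i}$; it is a graded central polynomial if all these values lie in the centre $Z(A)$; it is a proper graded central polynomial if moreover it is not a graded identity. $A$ satisfies the primeness property for graded central polynomials if, whenever $f,g\in K\langle X_G\rangle$ are polynomials in disjoint sets of variables such that $fg$ is a proper graded central polynomial, both $f$ and $g$ are proper graded central polynomials.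
   Formalization: The claim is stated for n ≥ 2 instead of n ≥ 1: for n = 1 the algebra is the field K with the trivial grading, where every polynomial is central and a product with an identity is an identity, so the primeness property holds. *)

theory Defs
  imports
    Jordan_Normal_Form.Matrix
    "HOL-Algebra.Elementary_Groups"
    "HOL-Library.Poly_Mapping"
    "HOL-Computational_Algebra.Polynomial"
begin

text \<open>
  The convolution product on \<^typ>\<open>'w \<Rightarrow>\<^sub>0 'k\<close> requires an additive monoid of exponents.
  Words are wrapped in a datatype of their own, so that the free monoid gets an additive
  notation without equipping the type of lists with an addition.
\<close>

datatype 'v word = Word (letters: "'v list")

instantiation word :: (type) monoid_add
begin

definition zero_word :: "'a word" where
  "0 = Word []"

definition plus_word :: "'a word \<Rightarrow> 'a word \<Rightarrow> 'a word" where
  "u + v = Word (letters u @ letters v)"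

instance
  by standard (simp_all add: zero_word_def plus_word_def)

end

type_synonym ('v, 'k) free_algebra = "'v word \<Rightarrow>\<^sub>0 'k"

definition vars :: "('v, 'k::zero) free_algebra \<Rightarrow> 'v set" where
  "vars f = (\<Union>w\<in>Poly_Mapping.keys f. set (letters w))"

text \<open>
  The variable \<open>(g, i)\<close> stands for the \<open>i\<close>-th variable of degree \<open>g\<close>. As the group \<open>G\<close> need not
  exhaust its type, the variables have to be restricted to degrees in \<^term>\<open>carrier G\<close>.
\<close>

definition free_graded_algebra ::
  "('g, 'm) monoid_scheme \<Rightarrow> ('g \<times> nat, 'k::zero) free_algebra set" where
  "free_graded_algebra G = {f. vars f \<subseteq> carrier G \<times> UNIV}"

definition eval_word :: "('k, 'a, 'm) module_scheme \<Rightarrow> ('v \<Rightarrow> 'a) \<Rightarrow> 'v word \<Rightarrow> 'a" where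
  "eval_word A \<phi> w = foldr (\<lambda>v a. \<phi> v \<otimes>\<^bsub>A\<^esub> a) (letters w) \<one>\<^bsub>A\<^esub>"

definition eval_poly ::
  "('k::zero, 'a, 'm) module_scheme \<Rightarrow> ('v \<Rightarrow> 'a) \<Rightarrow> ('v, 'k) free_algebra \<Rightarrow> 'a" where
  "eval_poly A \<phi> f =
     (\<Oplus>\<^bsub>A\<^esub>w\<in>Poly_Mapping.keys f. Poly_Mapping.lookup f w \<odot>\<^bsub>A\<^esub> eval_word A \<phi> w)"

definition centre :: "('a, 'm) monoid_scheme \<Rightarrow> 'a set" where
  "centre A = {z \<in> carrier A. \<forall>a\<in>carrier A. z \<otimes>\<^bsub>A\<^esub> a = a \<otimes>\<^bsub>A\<^esub> z}"

text \<open>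
  In the following, \<open>\<Gamma> g\<close> is the homogeneous component of degree \<open>g\<close> of the algebra \<open>A\<close>.
\<close>

definition graded_substitution ::
  "('g, 'm) monoid_scheme \<Rightarrow> ('g \<Rightarrow> 'a set) \<Rightarrow> ('g \<times> nat \<Rightarrow> 'a) \<Rightarrow> bool" where
  "graded_substitution G \<Gamma> \<phi> \<longleftrightarrow> (\<forall>g\<in>carrier G. \<forall>i. \<phi> (g, i) \<in> \<Gamma> g)"

definition graded_identity ::
  "('g, 'm) monoid_scheme \<Rightarrow> ('k::zero, 'a, 'n) module_scheme \<Rightarrow> ('g \<Rightarrow> 'a set) \<Rightarrow>
   ('g \<times> nat, 'k) free_algebra \<Rightarrow> bool" where
  "graded_identity G A \<Gamma> f \<longleftrightarrow>
     (\<forall>\<phi>. graded_substitution G \<Gamma> \<phi> \<longrightarrow> eval_poly A \<phi> f = \<zero>\<^bsub>A\<^esub>)"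

definition graded_central ::
  "('g, 'm) monoid_scheme \<Rightarrow> ('k::zero, 'a, 'n) module_scheme \<Rightarrow> ('g \<Rightarrow> 'a set) \<Rightarrow>
   ('g \<times> nat, 'k) free_algebra \<Rightarrow> bool" where
  "graded_central G A \<Gamma> f \<longleftrightarrow>
     (\<forall>\<phi>. graded_substitution G \<Gamma> \<phi> \<longrightarrow> eval_poly A \<phi> f \<in> centre A)"

definition proper_graded_central ::
  "('g, 'm) monoid_scheme \<Rightarrow> ('k::zero, 'a, 'n) module_scheme \<Rightarrow> ('g \<Rightarrow> 'a set) \<Rightarrow>
   ('g \<times> nat, 'k) free_algebra \<Rightarrow> bool" where
  "proper_graded_central G A \<Gamma> f \<longleftrightarrow> graded_central G A \<Gamma> f \<and> \<not> graded_identity G A \<Gamma> f"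

definition primeness_property ::
  "('g, 'm) monoid_scheme \<Rightarrow> ('k::semiring_0, 'a, 'n) module_scheme \<Rightarrow> ('g \<Rightarrow> 'a set) \<Rightarrow> bool"
  where
  "primeness_property G A \<Gamma> \<longleftrightarrow>
     (\<forall>f\<in>free_graded_algebra G. \<forall>g\<in>free_graded_algebra G.
        vars f \<inter> vars g = {} \<longrightarrow> proper_graded_central G A \<Gamma> (f * g) \<longrightarrow>
        proper_graded_central G A \<Gamma> f \<and> proper_graded_central G A \<Gamma> g)"

text \<open>
  The Pauli grading on \<open>n \<times> n\<close> matrices is of interest for \<open>n \<ge> 2\<close>. For \<open>n = 1\<close> it is the trivial
  grading on the field itself, which does satisfy the primeness property: every polynomial is
  central, and a product with an identity as a factor is an identity.
\<close>

definition primitive_root_of_unity :: "nat \<Rightarrow> 'k::monoid_mult \<Rightarrow> bool" where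
  "primitive_root_of_unity n \<epsilon> \<longleftrightarrow> \<epsilon> ^ n = 1 \<and> (\<forall>k. 0 < k \<and> k < n \<longrightarrow> \<epsilon> ^ k \<noteq> 1)"

text \<open>Matrix indices start at \<open>0\<close>.\<close>

definition pauli_X :: "nat \<Rightarrow> 'k::semiring_1 \<Rightarrow> 'k mat" where
  "pauli_X n \<epsilon> = mat n n (\<lambda>(i, j). if i = j then \<epsilon> ^ (n - 1 - i) else 0)"

definition pauli_Y :: "nat \<Rightarrow> 'k::semiring_1 mat" where
  "pauli_Y n = mat n n (\<lambda>(i, j). if j = (i + 1) mod n then 1 else 0)"

definition pauli_group :: "nat \<Rightarrow> (int \<times> int) monoid" where
  "pauli_group n = integer_mod_group n \<times>\<times> integer_mod_group n"

definition pauli_component :: "nat \<Rightarrow> 'k::semiring_1 \<Rightarrow> int \<times> int \<Rightarrow> 'k mat set" where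
  "pauli_component n \<epsilon> = (\<lambda>(i, j).
     {c \<cdot>\<^sub>m (pauli_X n \<epsilon> ^\<^sub>m nat i * pauli_Y n ^\<^sub>m nat j) | c. True})"

end

theory Submission
  imports Defs
begin

text \<open>
  Primeness fails already for a product of two variables. The matrix \<open>X\<close> is homogeneous of degree
  \<open>(1, 0)\<close> and satisfies \<open>X\<^sup>n = 1\<close>, so a variable of degree \<open>(1, 0)\<close> takes the values \<open>c X\<close> and a
  variable of degree \<open>(n - 1, 0)\<close> takes the values \<open>d X\<^sup>n\<^sup>-\<^sup>1\<close>. Their product takes exactly the
  scalar values \<open>c d\<close>, and is therefore a proper central polynomial. The first factor is not
  central, since it takes the value \<open>X\<close>, and \<open>X Y = \<epsilon> Y X\<close> with \<open>\<epsilon> \<noteq> 1\<close> as soon as \<open>n \<ge> 2\<close>.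
\<close>

definition gen :: "'v \<Rightarrow> ('v, 'k::zero_neq_one) free_algebra" where
  "gen v = Poly_Mapping.single (Word [v]) 1"

lemma gen_mult:
  "(gen v * gen w :: ('v, 'k::semiring_1) free_algebra) = Poly_Mapping.single (Word [v, w]) 1"
  by (simp add: gen_def mult_single plus_word_def)

lemma vars_gen [simp]: "vars (gen v) = {v}"
  by (simp add: vars_def gen_def)

lemma eval_poly_single_mat:
  fixes A :: "'k::comm_ring_1 mat"
  assumes "eval_word (module_mat TYPE('k) n n) \<phi> w = A" and "A \<in> carrier_mat n n"
  shows "eval_poly (module_mat TYPE('k) n n) \<phi> (Poly_Mapping.single w 1) = A"
proof -
  interpret abelian_group "module_mat TYPE('k) n n"
    by (rule abelian_group_mat)
  let ?M = "module_mat TYPE('k) n n"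
  let ?term = "\<lambda>u. Poly_Mapping.lookup (Poly_Mapping.single w 1) u \<odot>\<^bsub>?M\<^esub> eval_word ?M \<phi> u"
  have term_w: "?term w = A"
    unfolding assms(1) using assms(2) by (auto simp: module_mat_def)
  have carrier: "A \<in> carrier ?M"
    using assms(2) by (simp add: module_mat_def)
  have "finsum ?M ?term {w} = ?term w \<oplus>\<^bsub>?M\<^esub> finsum ?M ?term {}"
    by (rule finsum_insert) (simp_all only: term_w carrier, simp_all)
  also have "\<dots> = A"
    unfolding term_w using carrier by simp
  finally show ?thesis
    by (simp add: eval_poly_def)
qed

lemma eval_gen:
  assumes "\<phi> v \<in> carrier_mat n n"
  shows "eval_poly (module_mat TYPE('k::comm_ring_1) n n) \<phi> (gen v) = \<phi> v"
  unfolding gen_def using assms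
  by (intro eval_poly_single_mat) (simp_all add: eval_word_def module_mat_def)

lemma eval_gen_mult:
  assumes "\<phi> v \<in> carrier_mat n n" and "\<phi> w \<in> carrier_mat n n"
  shows "eval_poly (module_mat TYPE('k::comm_ring_1) n n) \<phi> (gen v * gen w) = \<phi> v * \<phi> w"
  unfolding gen_mult using assms
  by (intro eval_poly_single_mat) (simp_all add: eval_word_def module_mat_def)

lemma pauli_X_carrier [simp]: "pauli_X n \<epsilon> \<in> carrier_mat n n"
  by (simp add: pauli_X_def)

lemma pauli_Y_carrier [simp]: "pauli_Y n \<in> carrier_mat n n"
  by (simp add: pauli_Y_def)

lemma pauli_component_carrier: "A \<in> pauli_component n \<epsilon> g \<Longrightarrow> A \<in> carrier_mat n n"
  by (auto simp: pauli_component_def split: prod.splits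
      intro!: smult_carrier_mat mult_carrier_mat[of _ n n] pow_carrier_mat)

lemma pauli_X_diag: "pauli_X n \<epsilon> = mat_diag n (\<lambda>i. \<epsilon> ^ (n - 1 - i))"
  unfolding pauli_X_def mat_diag_def by (rule eq_matI) auto

lemma mat_diag_pow:
  fixes d :: "nat \<Rightarrow> 'k::comm_semiring_1"
  shows "mat_diag n d ^\<^sub>m k = mat_diag n (\<lambda>i. d i ^ k)"
  by (induction k) (simp_all add: mult.commute carrier_matD[OF mat_diag_dim])

lemma pauli_X_mult_pow:
  fixes \<epsilon> :: "'k::comm_semiring_1"
  assumes "n > 0" and "\<epsilon> ^ n = 1"
  shows "pauli_X n \<epsilon> * pauli_X n \<epsilon> ^\<^sub>m (n - 1) = 1\<^sub>m n"
proof -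
  have "(\<epsilon> ^ m) * (\<epsilon> ^ m) ^ (n - 1) = 1" for m
    using assms by (metis mult.commute power_eq_if power_mult power_one less_numeral_extra(3))
  then show ?thesis
    by (simp add: pauli_X_diag mat_diag_pow)
qed

lemma pauli_not_commute:
  fixes \<epsilon> :: "'k::field"
  assumes "n \<ge> 2" and "primitive_root_of_unity n \<epsilon>"
  shows "pauli_X n \<epsilon> * pauli_Y n \<noteq> pauli_Y n * pauli_X n \<epsilon>"
proof
  assume eq: "pauli_X n \<epsilon> * pauli_Y n = pauli_Y n * pauli_X n \<epsilon>"
  have "\<epsilon> ^ n = 1" and ne1: "\<epsilon> \<noteq> 1"
    using assms unfolding primitive_root_of_unity_def by (auto dest: spec[of _ 1])
  then have ne0: "\<epsilon> \<noteq> 0"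
    using assms(1) by (auto simp: power_0_left split: if_splits)
  \<comment> \<open>At a nonzero entry of \<open>Y\<close>, the two products differ by the ratio \<open>\<epsilon>\<close> of adjacent diagonal
    entries of \<open>X\<close>.\<close>
  have "(pauli_X n \<epsilon> * pauli_Y n) $$ (0, 1) = \<epsilon> ^ (n - 1)"
    using assms(1)
    by (simp add: pauli_X_diag mat_diag_mult_left[OF pauli_Y_carrier]) (simp add: pauli_Y_def)
  moreover have "(pauli_Y n * pauli_X n \<epsilon>) $$ (0, 1) = \<epsilon> ^ (n - 2)"
    using assms(1)
    by (simp add: pauli_X_diag mat_diag_mult_right[OF pauli_Y_carrier])
      (simp add: pauli_Y_def numeral_2_eq_2)
  ultimately have "\<epsilon> ^ (n - 1) = \<epsilon> ^ (n - 2)"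
    using eq by simp
  moreover have "n - 1 = Suc (n - 2)"
    using assms(1) by simp
  ultimately show False
    using ne0 ne1 by simp
qed

lemma pauli_component_X_power:
  fixes \<epsilon> :: "'k::comm_semiring_1"
  shows "pauli_component n \<epsilon> (int k, 0) = {c \<cdot>\<^sub>m pauli_X n \<epsilon> ^\<^sub>m k | c. True}"
  by (simp add: pauli_component_def pauli_Y_def right_mult_one_mat[of _ n n] pow_carrier_mat)

text \<open>
  A single substitution, by the monomials \<open>X\<^sup>iY\<^sup>j\<close> themselves, witnesses both that the first variable
  is not central and that the product is not an identity.
\<close>
lemma pauli_monomial_substitution:
  fixes \<epsilon> :: "'k::comm_semiring_1"
  shows "graded_substitution (pauli_group n) (pauli_component n \<epsilon>)
    (\<lambda>((i, j), _). pauli_X n \<epsilon> ^\<^sub>m nat i * pauli_Y n ^\<^sub>m nat j)"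
  unfolding graded_substitution_def pauli_component_def
  by (auto intro!: exI[of _ 1] eq_matI)

lemma scalar_mat_central:
  "c \<cdot>\<^sub>m 1\<^sub>m n \<in> centre (module_mat TYPE('k::comm_ring_1) n n)"
  by (auto simp: centre_def module_mat_def mult_smult_distrib[of _ n n _ n]
      mult_smult_assoc_mat[of _ n n _ n])

theorem corollary17:
  fixes \<epsilon> :: "'k::{alg_closed_field, field_char_0}" and n :: nat
  assumes "n \<ge> 2"
    and "primitive_root_of_unity n \<epsilon>"
  shows "\<not> primeness_property (pauli_group n) (module_mat TYPE('k) n n) (pauli_component n \<epsilon>)"
proof
  let ?G = "pauli_group n" and ?M = "module_mat TYPE('k) n n" and ?C = "pauli_component n \<epsilon>"
  let ?X = "pauli_X n \<epsilon>"
  assume prime: "primeness_property ?G ?M ?C"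
  \<comment> \<open>The two degrees coincide for \<open>n = 2\<close>, so the indices have to keep the variables distinct.\<close>
  define v where "v = ((int 1, 0 :: int), 0 :: nat)"
  define w where "w = ((int (n - 1), 0 :: int), 1 :: nat)"
  have deg: "(int 1, 0) \<in> carrier ?G" "(int (n - 1), 0) \<in> carrier ?G"
    using assms(1) by (auto simp: pauli_group_def DirProd_def integer_mod_group_def)
  have root: "\<epsilon> ^ n = 1"
    using assms(2) by (simp add: primitive_root_of_unity_def)
  have X_mult: "?X * ?X ^\<^sub>m (n - 1) = 1\<^sub>m n"
    using assms(1) root by (intro pauli_X_mult_pow) auto
  have value_carrier: "\<phi> v \<in> carrier_mat n n" "\<phi> w \<in> carrier_mat n n"
    if "graded_substitution ?G ?C \<phi>" for \<phi>
    using that deg unfolding graded_substitution_def v_def w_def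
    by (blast intro: pauli_component_carrier)+
  define \<mu> where "\<mu> = (\<lambda>((i, j), _ :: nat). ?X ^\<^sub>m nat i * pauli_Y n ^\<^sub>m nat j)"
  have \<mu>: "graded_substitution ?G ?C \<mu>"
    unfolding \<mu>_def by (rule pauli_monomial_substitution)
  have \<mu>_v: "\<mu> v = ?X" and \<mu>_w: "\<mu> w = ?X ^\<^sub>m (n - 1)"
    by (simp_all add: \<mu>_def v_def w_def pauli_Y_def right_mult_one_mat[of _ n n] pow_carrier_mat)
  have "graded_central ?G ?M ?C (gen v * gen w)"
    unfolding graded_central_def
  proof (intro allI impI)
    fix \<phi> assume \<phi>: "graded_substitution ?G ?C \<phi>"
    then have "\<phi> v \<in> ?C (int 1, 0)" "\<phi> w \<in> ?C (int (n - 1), 0)"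
      using deg unfolding graded_substitution_def v_def w_def by blast+
    then obtain c d where "\<phi> v = c \<cdot>\<^sub>m ?X" "\<phi> w = d \<cdot>\<^sub>m ?X ^\<^sub>m (n - 1)"
      unfolding pauli_component_X_power by auto
    then have "\<phi> v * \<phi> w = d \<cdot>\<^sub>m (c \<cdot>\<^sub>m (?X * ?X ^\<^sub>m (n - 1)))"
      by (simp add: mult_smult_distrib[of _ n n _ n] mult_smult_assoc_mat[of _ n n _ n]
          pow_carrier_mat)
    also have "\<dots> = (d * c) \<cdot>\<^sub>m 1\<^sub>m n"
      unfolding X_mult by (rule eq_matI) simp_all
    finally have "\<phi> v * \<phi> w = (d * c) \<cdot>\<^sub>m 1\<^sub>m n" .
    then show "eval_poly ?M \<phi> (gen v * gen w) \<in> centre ?M"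
      using value_carrier[OF \<phi>] by (simp add: eval_gen_mult scalar_mat_central)
  qed
  moreover have "\<not> graded_identity ?G ?M ?C (gen v * gen w)"
  proof
    assume "graded_identity ?G ?M ?C (gen v * gen w)"
    then have "eval_poly ?M \<mu> (gen v * gen w) = 0\<^sub>m n n"
      using \<mu> by (simp add: graded_identity_def module_mat_simps)
    then have "1\<^sub>m n = (0\<^sub>m n n :: 'k mat)"
      using eval_gen_mult[of \<mu> v n w, OF value_carrier[OF \<mu>]] by (simp only: \<mu>_v \<mu>_w X_mult)
    then have "(1\<^sub>m n :: 'k mat) $$ (0, 0) = 0\<^sub>m n n $$ (0, 0)"
      by (rule arg_cong)
    then show False
      using assms(1) by simp
  qed
  moreover have "gen v \<in> free_graded_algebra ?G" "gen w \<in> free_graded_algebra ?G"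
    using deg by (simp_all add: free_graded_algebra_def v_def w_def)
  moreover have "vars (gen v) \<inter> vars (gen w) = {}"
    by (simp add: v_def w_def)
  ultimately have "graded_central ?G ?M ?C (gen v)"
    using prime unfolding primeness_property_def proper_graded_central_def by (metis vars_gen)
  then have "?X \<in> centre ?M"
    using \<mu> value_carrier[OF \<mu>] by (metis graded_central_def eval_gen \<mu>_v)
  then have "?X * pauli_Y n = pauli_Y n * ?X"
    by (simp add: centre_def module_mat_def)
  then show False
    using pauli_not_commute[OF assms] by contradiction
qed

end
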